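(* Consider interaction indices on products of finite chains defined as follows. For a finite index set $M$ with $|M|=m\geq1$, finite chains $(L_k)_{k\in M}$ (with bottoms $\bot_k$, tops $\top_k$), $L=\prod_{k\in M}L_k$ with the product order, a function $v:L\to\mathbb{R}$, a nonempty $J\subseteq M$ and $x\in L$ with $x_k=\bot_k$ for $k\notin J$ and $x_k\neq\bot_k$ for $k\in J$ (write $i_k:=x_k$ and $\underline{i_k}$ for its predecessor in $L_k$), set \[I^v(x):=\sum_{y}\alpha^{|J|}_{h(y)}(m)\,\Delta_x v(y),\] the sum running over all $y\in L$ with $y_k\in\{\bot_k,\top_k\}$ for $k\notin J$ and $y_k=\underline{i_k}$ for $k\in J$, where $\alpha^{j}_{h}(m)$ are real constants depending only on $m$, $j$ and $h$, $h(y)$ is the number of coordinates with $y_l=\top_l$, and $\Delta_x v(y):=\sum_{A\subseteq J}(-1)^{|J\setminus A|}v(y^A)$ with $y^A_k=i_k$ for $k\in A$ and $y^A_k=y_k$ otherwise. Suppose that for all such data (with $N$ denoting the index set $M$ and $n=|N|$) the recursion formula \[I^v(x)=I^{v^{[x]}}(\bot_{N\setminus J},\top_{[x]})-\sum_{K\subseteq J,\ K\neq\emptyset,J}I^{v^{N\setminus K}_x}(x_{|N\setminus K})\] holds, where: $v^{N\setminus K}_x:\prod_{k\in N\setminus K}L_k\to\mathbb{R}$ is given by $v^{N\setminus K}_x(y)=v(y')$ with $y'_k=\underline{i_k}$ for $k\in K$ and $y'_k=y_k$ otherwise; $x_{|N\setminus K}$ is the restriction of $x$ to the coordinates in $N\setminus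 K$; $v^{[x]}$ is the function on $\prod_{k\in N\setminus J}L_k\times\{\bot_{[x]},\top_{[x]}\}$ (a new coordinate $[x]$ carrying the two-element chain $\bot_{[x]}<\top_{[x]}$) given by $v^{[x]}(y)=v(y')$ with $y'_k=i_k$ if $k\in J$ and $y_{[x]}=\top_{[x]}$, $y'_k=\underline{i_k}$ if $k\in J$ and $y_{[x]}=\bot_{[x]}$, and $y'_k=y_k$ if $k\notin J$; and $(\bot_{N\setminus J},\top_{[x]})$ is the element of that domain with all coordinates bottom except the $[x]$-coordinate equal to $\top_{[x]}$. Then \[\alpha^j_k(n)=\alpha^1_k(n-j+1)\qquad\text{for all } j=1,\ldots,n,\ k=0,\ldots,n-j.\]
   Context: A chain is a totally ordered set; "predecessor" of a non-bottom element $a$ of a finite chain is the unique element covered by $a$. All interaction indices appearing in the recursion formula are computed with the same family of coefficients $\alpha^j_h(m)$, where $m$ is the number of coordinates of the domain of the function involved and $j$ is the number of non-bottom coordinates of the argument. *)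

theory Defs
  imports Complex_Main "HOL-Library.FuncSet"
begin

text \<open>
  A finite chain is a finite nonempty subset of a linearly ordered type, with bottom \<^term>\<open>Min C\<close>
  and top \<^term>\<open>Max C\<close>. The product of the chains \<^term>\<open>L k\<close>, \<^term>\<open>k \<in> M\<close>, is \<^term>\<open>Pi\<^sub>E M L\<close>.
  A real function on the product is a function on \<^typ>\<open>'i \<Rightarrow> 'a\<close>, of which only the values on
  \<^term>\<open>Pi\<^sub>E M L\<close> matter.
\<close>

definition finite_chain :: "'a::linorder set \<Rightarrow> bool" where
  "finite_chain C \<longleftrightarrow> finite C \<and> C \<noteq> {}"

definition covered_by :: "'a::linorder set \<Rightarrow> 'a \<Rightarrow> 'a \<Rightarrow> bool" where
  "covered_by C b a \<longleftrightarrow> b \<in> C \<and> a \<in> C \<and> b < a \<and> \<not> (\<exists>c\<in>C. b < c \<and> c < a)"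

definition predecessor :: "'a::linorder set \<Rightarrow> 'a \<Rightarrow> 'a" where
  "predecessor C a = (THE b. covered_by C b a)"

definition support :: "'i set \<Rightarrow> ('i \<Rightarrow> 'a::linorder set) \<Rightarrow> ('i \<Rightarrow> 'a) \<Rightarrow> 'i set" where
  "support M L x = {k \<in> M. x k \<noteq> Min (L k)}"

definition num_tops :: "'i set \<Rightarrow> ('i \<Rightarrow> 'a::linorder set) \<Rightarrow> ('i \<Rightarrow> 'a) \<Rightarrow> nat" where
  "num_tops M L y = card {l \<in> M. y l = Max (L l)}"

definition Delta ::
  "'i set \<Rightarrow> ('i \<Rightarrow> 'a) \<Rightarrow> (('i \<Rightarrow> 'a) \<Rightarrow> real) \<Rightarrow> ('i \<Rightarrow> 'a) \<Rightarrow> real" where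
  "Delta J x v y = (\<Sum>A\<in>Pow J. (-1) ^ card (J - A) * v (override_on y x A))"

definition summation_points ::
  "'i set \<Rightarrow> ('i \<Rightarrow> 'a::linorder set) \<Rightarrow> 'i set \<Rightarrow> ('i \<Rightarrow> 'a) \<Rightarrow> ('i \<Rightarrow> 'a) set" where
  "summation_points M L J x =
     {y \<in> Pi\<^sub>E M L. (\<forall>k\<in>M - J. y k \<in> {Min (L k), Max (L k)}) \<and>
                  (\<forall>k\<in>J. y k = predecessor (L k) (x k))}"

text \<open>The coefficient \<open>\<alpha>\<^sup>j\<^sub>h(m)\<close> is \<^term>\<open>\<alpha> j h m\<close>; the set \<open>J\<close> is recovered from \<open>x\<close>.\<close>

definition interaction ::
  "(nat \<Rightarrow> nat \<Rightarrow> nat \<Rightarrow> real) \<Rightarrow> 'i set \<Rightarrow> ('i \<Rightarrow> 'a::linorder set) \<Rightarrow>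
   (('i \<Rightarrow> 'a) \<Rightarrow> real) \<Rightarrow> ('i \<Rightarrow> 'a) \<Rightarrow> real" where
  "interaction \<alpha> M L v x =
     (let J = support M L x in
      \<Sum>y\<in>summation_points M L J x. \<alpha> (card J) (num_tops M L y) (card M) * Delta J x v y)"

text \<open>\<open>v\<^sub>x\<^bsup>N\<setminus>K\<^esup>\<close>, a function on \<^term>\<open>Pi\<^sub>E (N - K) L\<close>.\<close>

definition restricted_game ::
  "('i \<Rightarrow> 'a::linorder set) \<Rightarrow> (('i \<Rightarrow> 'a) \<Rightarrow> real) \<Rightarrow> ('i \<Rightarrow> 'a) \<Rightarrow> 'i set \<Rightarrow> ('i \<Rightarrow> 'a) \<Rightarrow> real" where
  "restricted_game L v x K y = v (override_on y (\<lambda>k. predecessor (L k) (x k)) K)"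

text \<open>
  Merging the coordinates in \<open>J\<close> into one new coordinate \<open>[x]\<close>: the new coordinate is \<^term>\<open>None\<close>,
  carrying the chain \<open>0 < 1\<close>, and an old coordinate \<open>k\<close> becomes \<^term>\<open>Some k\<close>.
\<close>

definition merged_index :: "'i set \<Rightarrow> 'i set \<Rightarrow> 'i option set" where
  "merged_index N J = insert None (Some ` (N - J))"

definition merged_chains :: "('i \<Rightarrow> nat set) \<Rightarrow> 'i option \<Rightarrow> nat set" where
  "merged_chains L = case_option {0, 1} L"

definition merged_game ::
  "('i \<Rightarrow> nat set) \<Rightarrow> (('i \<Rightarrow> nat) \<Rightarrow> real) \<Rightarrow> 'i set \<Rightarrow> ('i \<Rightarrow> nat) \<Rightarrow> ('i option \<Rightarrow> nat) \<Rightarrow> real" where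
  "merged_game L v J x y =
     v (\<lambda>k. if k \<in> J then (if y None = 1 then x k else predecessor (L k) (x k)) else y (Some k))"

definition merged_point :: "('i \<Rightarrow> nat set) \<Rightarrow> 'i set \<Rightarrow> 'i set \<Rightarrow> 'i option \<Rightarrow> nat" where
  "merged_point L N J = restrict (case_option 1 (\<lambda>k. Min (L k))) (merged_index N J)"

end

theory Submission
  imports Defs
begin

text \<open>
  On a product of two-element chains, let \<open>v\<close> be the indicator of the point whose top coordinates are
  exactly those in \<open>J \<union> T\<close>, where \<open>T\<close> is a \<open>k\<close>-element set disjoint from \<open>J\<close>. Only one summand of
  the interaction index at \<open>J\<close> survives, so the index is \<open>\<alpha>\<^sup>j\<^sub>k(n)\<close>. Merging \<open>J\<close> gives a function of the
  same kind, with index \<open>\<alpha>\<^sup>1\<^sub>k(n - j + 1)\<close>, whereas every restricted game is zero because a coordinate in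
  \<open>J\<close> is frozen at its bottom. The recursion then equates the two coefficients.
\<close>

lemma predecessor_two [simp]: "predecessor {0, Suc 0} (Suc 0) = 0"
  unfolding predecessor_def by (rule the_equality) (auto simp: covered_by_def)

text \<open>The index type is left arbitrary because the lemma serves twice: for the original
  product, and for the merged one, where the single coordinate \<open>None\<close> takes the part of
  \<open>J\<close>.\<close>

lemma interaction_indicator:
  fixes x :: "'i \<Rightarrow> nat" and v :: "('i \<Rightarrow> nat) \<Rightarrow> real"
  assumes fin: "finite M" and JM: "J \<subseteq> M" and TM: "T \<subseteq> M - J"
    and L: "\<And>k. k \<in> M \<Longrightarrow> L k = {0, 1}"
    and x: "\<And>k. k \<in> M \<Longrightarrow> x k = of_bool (k \<in> J)"
    and v: "\<And>z. v z = of_bool (\<forall>k\<in>M. z k = of_bool (k \<in> J \<union> T))"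
  shows "interaction \<alpha> M L v x = \<alpha> (card J) (card T) (card M)"
proof -
  \<comment> \<open>The one summation point with a nonzero difference: bottom on \<open>J\<close>,
    and raising \<open>J\<close> to the top yields exactly the point that \<open>v\<close> detects.
    The \<open>restrict\<close> puts it into \<open>Pi\<^sub>E M L\<close>.\<close>
  define y0 :: "'i \<Rightarrow> nat" where "y0 = restrict (\<lambda>k. of_bool (k \<in> T)) M"
  let ?S = "summation_points M L J x"
  have supp: "support M L x = J"
    using JM by (auto simp: support_def L x)
  have S: "?S = {y \<in> Pi\<^sub>E M L. \<forall>k\<in>J. y k = 0}"
  proof -
    have "predecessor (L k) (x k) = 0" if "k \<in> J" for k
      using that JM by (auto simp: L x subset_iff)
    \<comment> \<open>A two-element chain contains only its bottom and its top, so the condition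
      outside \<open>J\<close> holds automatically.\<close>
    moreover have "y k \<in> {Min (L k), Max (L k)}" if "y \<in> Pi\<^sub>E M L" "k \<in> M" for y k
      using PiE_mem[OF that] L[OF that(2)] by auto
    ultimately show ?thesis
      unfolding summation_points_def by auto
  qed
  have finS: "finite ?S"
    unfolding S by (rule finite_subset[OF _ finite_PiE[OF fin, of L]]) (auto simp: L)
  have y0S: "y0 \<in> ?S"
    unfolding S using JM TM by (auto simp: y0_def L)
  have Delta: "Delta J x v y = of_bool (y = y0)" if y: "y \<in> ?S" for y
  proof -
    have yJ: "y k = 0" if "k \<in> J" for k
      using y that by (simp add: S)
    have ext: "y \<in> extensional M"
      using y by (auto simp: S PiE_iff)
    \<comment> \<open>On \<open>J\<close> the modified point is the indicator of \<open>A\<close>,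
      so it matches only if \<open>A = J\<close>; outside \<open>J\<close> it is still
      \<open>y\<close>, which must be the indicator of \<open>T\<close>. The surviving sign is
      \<open>(-1) ^ 0\<close>.\<close>
    have val: "v (override_on y x A) = of_bool (A = J \<and> y = y0)" if A: "A \<subseteq> J" for A
    proof -
      have "(\<forall>k\<in>M. override_on y x A k = of_bool (k \<in> J \<union> T)) \<longleftrightarrow> A = J \<and> y = y0"
      proof
        assume *: "\<forall>k\<in>M. override_on y x A k = of_bool (k \<in> J \<union> T)"
        have "J \<subseteq> A"
        proof
          fix k assume k: "k \<in> J"
          then have "override_on y x A k = 1" using * JM by auto
          then show "k \<in> A" using yJ[OF k] by (cases "k \<in> A") auto
        qed
        with A have AJ: "A = J" by blast
        have "y k = y0 k" if "k \<in> M" for k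
          using *[rule_format, OF that] that yJ[of k] TM
          by (cases "k \<in> J") (auto simp: y0_def AJ)
        then have "y = y0"
          using ext by (intro extensionalityI[of y M]) (auto simp: y0_def)
        with AJ show "A = J \<and> y = y0" ..
      next
        assume "A = J \<and> y = y0"
        then show "\<forall>k\<in>M. override_on y x A k = of_bool (k \<in> J \<union> T)"
          by (auto simp: override_on_def y0_def x)
      qed
      then show ?thesis unfolding v by simp
    qed
    have "Delta J x v y = (\<Sum>A\<in>Pow J. if A = J then of_bool (y = y0) else 0)"
      unfolding Delta_def by (rule sum.cong) (auto simp: val)
    also have "\<dots> = of_bool (y = y0)"
      using finite_subset[OF JM fin] by (subst sum.delta) auto
    finally show ?thesis .
  qed
  have tops: "num_tops M L y0 = card T"
    unfolding num_tops_def using TM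
    by (intro arg_cong[of _ _ card]) (auto simp: y0_def L)
  have "interaction \<alpha> M L v x =
      (\<Sum>y\<in>?S. if y = y0 then \<alpha> (card J) (card T) (card M) else 0)"
    unfolding interaction_def Let_def supp by (rule sum.cong) (auto simp: Delta tops)
  then show ?thesis
    using finS y0S by simp
qed

lemma interaction_zero: "(\<And>z. v z = 0) \<Longrightarrow> interaction \<alpha> M L v x = 0"
  by (simp add: interaction_def Delta_def Let_def)

theorem theorem5:
  fixes \<alpha> :: "nat \<Rightarrow> nat \<Rightarrow> nat \<Rightarrow> real"
  assumes recursion:
    "\<And>(N :: nat set) (L :: nat \<Rightarrow> nat set) (v :: (nat \<Rightarrow> nat) \<Rightarrow> real) (J :: nat set) (x :: nat \<Rightarrow> nat).
       finite N \<Longrightarrow> N \<noteq> {} \<Longrightarrow> (\<And>k. k \<in> N \<Longrightarrow> finite_chain (L k)) \<Longrightarrow>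
       J \<subseteq> N \<Longrightarrow> J \<noteq> {} \<Longrightarrow> x \<in> Pi\<^sub>E N L \<Longrightarrow>
       (\<And>k. k \<in> N - J \<Longrightarrow> x k = Min (L k)) \<Longrightarrow> (\<And>k. k \<in> J \<Longrightarrow> x k \<noteq> Min (L k)) \<Longrightarrow>
       interaction \<alpha> N L v x =
         interaction \<alpha> (merged_index N J) (merged_chains L) (merged_game L v J x) (merged_point L N J)
         - (\<Sum>K\<in>{K. K \<subseteq> J \<and> K \<noteq> {} \<and> K \<noteq> J}.
              interaction \<alpha> (N - K) L (restricted_game L v x K) (restrict x (N - K)))"
  shows "\<forall>n. \<forall>j\<in>{1..n}. \<forall>k\<in>{0..n - j}. \<alpha> j k n = \<alpha> 1 k (n - j + 1)"
proof (intro allI ballI)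
  fix n j k :: nat
  assume j: "j \<in> {1..n}" and k: "k \<in> {0..n - j}"
  define N where "N = {..<n}"
  define J where "J = {..<j}"
  \<comment> \<open>The \<open>k\<close> indices following \<open>J\<close>; they fit into
    \<open>N\<close> because \<open>k \<le> n - j\<close>.\<close>
  define T where "T = {j..<j + k}"
  define L :: "nat \<Rightarrow> nat set" where "L = (\<lambda>_. {0, 1})"
  define x :: "nat \<Rightarrow> nat" where "x = restrict (\<lambda>i. of_bool (i \<in> J)) N"
  define v :: "(nat \<Rightarrow> nat) \<Rightarrow> real" where
    "v = (\<lambda>z. of_bool (\<forall>i\<in>N. z i = of_bool (i \<in> J \<union> T)))"
  have N: "finite N" "N \<noteq> {}" and J: "J \<subseteq> N" "J \<noteq> {}" and T: "T \<subseteq> N - J"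
    using j k by (auto simp: N_def J_def T_def lessThan_empty_iff)
  have cards: "card N = n" "card J = j" "card T = k"
    by (simp_all add: N_def J_def T_def)
  have xJ: "x i = 1" if "i \<in> J" for i
    using that J by (auto simp: x_def)
  have lhs: "interaction \<alpha> N L v x = \<alpha> j k n"
    using interaction_indicator[OF N(1) J(1) T, of L x v \<alpha>] cards
    by (simp add: L_def x_def v_def)
  have card_merged: "card (merged_index N J) = n - j + 1"
    using N J by (simp add: merged_index_def card_insert_if image_iff card_image card_Diff_subset
        finite_subset[OF J(1) N(1)] cards)
  \<comment> \<open>Since \<open>J\<close> is nonempty, \<open>z None\<close> must be
    \<open>1\<close>: any other value sends the coordinates in \<open>J\<close> to their predecessor
    \<open>0\<close>, where \<open>v\<close> demands \<open>1\<close>.\<close>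
  have merged_v: "merged_game L v J x z =
      of_bool (\<forall>i\<in>merged_index N J. z i = of_bool (i \<in> {None} \<union> Some ` T))" for z
  proof -
    have "(\<forall>i\<in>N. (if i \<in> J then (if z None = 1 then x i else predecessor (L i) (x i))
              else z (Some i)) = of_bool (i \<in> J \<union> T)) \<longleftrightarrow>
          z None = 1 \<and> (\<forall>i\<in>N - J. z (Some i) = of_bool (i \<in> T))" (is "?l \<longleftrightarrow> ?r")
    proof
      assume l: ?l
      obtain i where i: "i \<in> J" using J by blast
      then have "i \<in> N" using J by blast
      with l i have "z None = 1"
        by (auto simp: xJ L_def split: if_splits)
      moreover have "z (Some i) = of_bool (i \<in> T)" if "i \<in> N - J" for i
        using l that by auto
      ultimately show ?r by blast
    next
      assume ?r
      then show ?l by (auto simp: xJ)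
    qed
    moreover have "?r \<longleftrightarrow> (\<forall>i\<in>merged_index N J. z i = of_bool (i \<in> {None} \<union> Some ` T))"
      by (auto simp: merged_index_def)
    ultimately show ?thesis
      unfolding merged_game_def v_def by simp
  qed
  have merged: "interaction \<alpha> (merged_index N J) (merged_chains L) (merged_game L v J x)
      (merged_point L N J) = \<alpha> 1 k (n - j + 1)"
  proof -
    have "interaction \<alpha> (merged_index N J) (merged_chains L) (merged_game L v J x)
        (merged_point L N J) = \<alpha> (card {None :: nat option}) (card (Some ` T)) (card (merged_index N J))"
      using N T
      by (intro interaction_indicator merged_v)
        (auto simp: merged_index_def merged_chains_def merged_point_def L_def)
    then show ?thesis
      by (simp add: card_merged card_image cards)
  qed
  have restricted: "interaction \<alpha> (N - K) L (restricted_game L v x K) (restrict x (N - K)) = 0"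
    if K: "K \<subseteq> J" "K \<noteq> {}" for K
  proof (rule interaction_zero)
    fix z
    obtain i where i: "i \<in> K" using K by blast
    then have "i \<in> J" "i \<in> N" using K J by auto
    then have "override_on z (\<lambda>i. predecessor (L i) (x i)) K i \<noteq> of_bool (i \<in> J \<union> T)"
      using i by (simp add: xJ L_def)
    then show "restricted_game L v x K z = 0"
      unfolding restricted_game_def v_def of_bool_eq_0_iff using \<open>i \<in> N\<close> by blast
  qed
  have "interaction \<alpha> N L v x = \<alpha> 1 k (n - j + 1) -
      (\<Sum>K\<in>{K. K \<subseteq> J \<and> K \<noteq> {} \<and> K \<noteq> J}.
         interaction \<alpha> (N - K) L (restricted_game L v x K) (restrict x (N - K)))"
    unfolding merged[symmetric] using N J
    by (intro recursion) (auto simp: finite_chain_def L_def x_def)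
  then show "\<alpha> j k n = \<alpha> 1 k (n - j + 1)"
    by (simp add: lhs restricted)
qed

end
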